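(* Let ${\bm{P}}\succ0$ and ${\bm{H}}\succeq0$ be symmetric $d\times d$ matrices with ${\bm{P}}{\bm{H}}={\bm{H}}{\bm{P}}$, and let $\tilde\lambda_1\ge\cdots\ge\tilde\lambda_d>0$ be the eigenvalues of ${\bm{P}}^{-1}{\bm{H}}$. Fix $\eta>0$, $\beta_1\in[0,1)$, and set $\tilde\eta:=(1-\beta_1)\eta$. Let $\sigma_1,\ldots,\sigma_d>0$ be such that, in an orthonormal basis simultaneously diagonalizing ${\bm{P}}$ and ${\bm{H}}$, ${\bm{P}}=\mathrm{diag}(\sigma_1,\ldots,\sigma_d)$ and ${\bm{P}}^{-1/2}{\bm{H}}{\bm{P}}^{-1/2}=\mathrm{diag}(\tilde\lambda_1,\ldots,\tilde\lambda_d)$. Let ${\mathcal{X}}:=(\mathbb{S}^2)^d$, ${\mathcal{K}}:=(\mathbb{S}^2_+)^d$, and define ${\mathcal{T}}_{\mathrm{adam}}:{\mathcal{X}}\to{\mathcal{X}}$ by \[ ({\mathcal{T}}_{\mathrm{adam}}({\bm{W}}))_i={\bm{A}}_i{\bm{W}}_i{\bm{A}}_i^\top+\tilde\eta^2\Bigl(\tilde\lambda_i^2({\bm{W}}_i)_{11}+\sigma_i^{-1}\sum_{j=1}^d\sigma_j\tilde\lambda_j^2({\bm{W}}_j)_{11}\Bigr){\bm{Q}},\quad i=1,\ldots,d, \] with ${\bm{A}}_i=\begin{bmatrix}1-\tilde\eta\tilde\lambda_i&-\beta_1\\ \tilde\eta\tilde\lambda_i&\beta_1\end{bmatrix}$,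 ${\bm{Q}}=\begin{bmatrix}1&-1\\-1&1\end{bmatrix}$. Let $S_{\mathrm{adam}}(\eta,\beta_1):=\sum_{i=1}^d\frac{\eta\tilde\lambda_i}{2\left(1-\frac{\eta\tilde\lambda_i}{1+\beta_1}\right)}$. Then: (a) ${\mathcal{T}}_{\mathrm{adam}}({\mathcal{K}})\subseteq{\mathcal{K}}$; moreover ${\mathcal{T}}_{\mathrm{adam}}$ has an eigenvalue equal to its spectral radius $\rho({\mathcal{T}}_{\mathrm{adam}})$ with an associated eigenvector ${\bm{W}}^\star\in{\mathcal{K}}\setminus\{{\bm{0}}\}$, and $\rho({\mathcal{T}}_{\mathrm{adam}})\ge\tilde\eta^2\sum_{i=1}^d\tilde\lambda_i^2>0$ and $\sum_{i=1}^d({\bm{W}}_i^\star)_{11}>0$. (b) $\rho({\mathcal{T}}_{\mathrm{adam}})=1$ if and only if $\eta\tilde\lambda_1<1+\beta_1$ and $S_{\mathrm{adam}}(\eta,\beta_1)=1$. (c) $\rho({\mathcal{T}}_{\mathrm{adam}})<1$ if and only if $\eta\tilde\lambda_1<1+\beta_1$ and $S_{\mathrm{adam}}(\eta,\beta_1)<1$.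
   Context: $\mathbb{S}^2$ denotes the space of real symmetric $2\times2$ matrices and $\mathbb{S}^2_+$ the cone of positive semidefinite ones; $\rho(\cdot)$ denotes spectral radius. *)

theory Defs
  imports Complex_Main "Jordan_Normal_Form.Char_Poly"
begin

text \<open>Matrices are Jordan_Normal_Form matrices (type 'a mat), indices 0-based:
  index i in {0..<d} corresponds to index i+1 of the paper.\<close>

definition diag_of :: "nat \<Rightarrow> (nat \<Rightarrow> 'a::zero) \<Rightarrow> 'a mat" where
  "diag_of d f = mat d d (\<lambda>(i,j). if i = j then f i else 0)"

definition pos_def_mat :: "nat \<Rightarrow> real mat \<Rightarrow> bool" where
  "pos_def_mat n M \<longleftrightarrow> M \<in> carrier_mat n n \<and> M\<^sup>T = M \<and>
     (\<forall>x \<in> carrier_vec n. x \<noteq> 0\<^sub>v n \<longrightarrow> x \<bullet> (M *\<^sub>v x) > 0)"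

definition psd_mat :: "nat \<Rightarrow> real mat \<Rightarrow> bool" where
  "psd_mat n M \<longleftrightarrow> M \<in> carrier_mat n n \<and> M\<^sup>T = M \<and>
     (\<forall>x \<in> carrier_vec n. x \<bullet> (M *\<^sub>v x) \<ge> 0)"

text \<open>The 2x2 matrices A_i (with parameter l = lambda_i, et = eta tilde, b = beta_1) and Q,
  over any real algebra (real for the operator itself, complex for its complexification).\<close>

definition A_adam :: "real \<Rightarrow> real \<Rightarrow> real \<Rightarrow> 'a::{comm_ring_1,real_algebra_1} mat" where
  "A_adam et b l = mat_of_rows_list 2
     [[of_real (1 - et * l), of_real (- b)], [of_real (et * l), of_real b]]"

definition Q_adam :: "'a::{comm_ring_1} mat" where
  "Q_adam = mat_of_rows_list 2 [[1, -1], [-1, 1]]"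

text \<open>The space X = (S^2)^d (or its complexification: complex symmetric 2x2 matrices),
  elements represented as functions nat => 2x2 matrix, zero outside {0..<d}.\<close>

definition X_space :: "nat \<Rightarrow> (nat \<Rightarrow> 'a::comm_ring_1 mat) set" where
  "X_space d = {W. (\<forall>i<d. W i \<in> carrier_mat 2 2 \<and> (W i)\<^sup>T = W i) \<and> (\<forall>i\<ge>d. W i = 0\<^sub>m 2 2)}"

definition K_cone :: "nat \<Rightarrow> (nat \<Rightarrow> real mat) set" where
  "K_cone d = {W \<in> X_space d. \<forall>i<d. psd_mat 2 (W i)}"

definition X_zero :: "nat \<Rightarrow> 'a::comm_ring_1 mat" where
  "X_zero i = 0\<^sub>m 2 2"

definition X_smult :: "'a::comm_ring_1 \<Rightarrow> (nat \<Rightarrow> 'a mat) \<Rightarrow> nat \<Rightarrow> 'a mat" where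
  "X_smult c W i = c \<cdot>\<^sub>m W i"

definition T_adam :: "nat \<Rightarrow> (nat \<Rightarrow> real) \<Rightarrow> (nat \<Rightarrow> real) \<Rightarrow> real \<Rightarrow> real \<Rightarrow>
    (nat \<Rightarrow> 'a::{comm_ring_1,real_algebra_1} mat) \<Rightarrow> nat \<Rightarrow> 'a mat" where
  "T_adam d \<sigma> lam \<eta> \<beta> W i =
     (let et = (1 - \<beta>) * \<eta> in
      if i < d then
        A_adam et \<beta> (lam i) * W i * (A_adam et \<beta> (lam i))\<^sup>T +
        (of_real (et\<^sup>2) * (of_real ((lam i)\<^sup>2) * W i $$ (0,0) +
           of_real (1 / \<sigma> i) * (\<Sum>j<d. of_real (\<sigma> j * (lam j)\<^sup>2) * W j $$ (0,0)))) \<cdot>\<^sub>m Q_adam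
      else 0\<^sub>m 2 2)"

definition rho_adam :: "nat \<Rightarrow> (nat \<Rightarrow> real) \<Rightarrow> (nat \<Rightarrow> real) \<Rightarrow> real \<Rightarrow> real \<Rightarrow> real" where
  "rho_adam d \<sigma> lam \<eta> \<beta> = Sup {cmod \<mu> | \<mu>. \<exists>W \<in> (X_space d :: (nat \<Rightarrow> complex mat) set).
      W \<noteq> X_zero \<and> T_adam d \<sigma> lam \<eta> \<beta> W = X_smult \<mu> W}"

definition S_adam :: "nat \<Rightarrow> (nat \<Rightarrow> real) \<Rightarrow> real \<Rightarrow> real \<Rightarrow> real" where
  "S_adam d lam \<eta> \<beta> = (\<Sum>i<d. \<eta> * lam i / (2 * (1 - \<eta> * lam i / (1 + \<beta>))))"

end

theory Submission
  imports Defs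
begin

text \<open>In the coordinates \<open>(x, x + y)\<close> the eigenvalue equation of the operator can be solved block by
  block. With \<open>s = (1 - \<beta>) \<eta> \<lambda>\<close>, the top-left entry \<open>p\<close> of a block of an eigenvector for \<open>\<mu>\<close>
  satisfies \<open>block_gap \<beta> s \<mu> * p = ((1 - \<beta>) \<eta>)\<^sup>2 / \<sigma> * \<phi>\<close>, where the coupling \<open>\<phi>\<close> is the sum of
  all \<open>\<sigma> j (\<lambda> j)\<^sup>2 (p j)\<close>. Hence a real \<open>\<mu> > \<beta>\<close> at which all gaps are positive is an eigenvalue as soon
  as the sum of the quotients \<open>s\<^sup>2 / gap\<close> is 1, and the eigenvector is then positive definite in every
  block. Gaps increase where they are positive, so there is exactly one such root \<open>r\<close>.
  As the operator preserves the cone and its eigenvector for \<open>r\<close> is an interior point, the eigenvector dominates every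
  complex eigenvector, so that \<open>r\<close> is the spectral radius. At \<open>\<mu> = 1\<close> the sum of quotients is
  \<open>S_adam\<close>, and comparing \<open>r\<close> with 1 is comparing \<open>S_adam\<close> with 1 by monotonicity.\<close>

section \<open>The gap of one block as a function of the eigenvalue\<close>

text \<open>With \<open>t = 1 + \<beta> - s\<close>, \<open>m = t * p / (\<mu> + \<beta>)\<close>
  and \<open>v = p / \<mu>\<close>, this is the coefficient of \<open>p\<close> in \<open>\<mu> * p
  - (t^2 * p - 2 * \<beta> * t * m + \<beta>^2 * v) - s^2 * p\<close>; the last term is the block's
  own share of the multiple of \<open>Q_adam\<close>.\<close>

definition block_gap :: "real \<Rightarrow> real \<Rightarrow> real \<Rightarrow> real" where
  "block_gap \<beta> s \<mu> = \<mu> - (1 + \<beta> - s)\<^sup>2 * (\<mu> - \<beta>) / (\<mu> + \<beta>) - \<beta>\<^sup>2 / \<mu> - s\<^sup>2"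

text \<open>Since \<open>\<mu> - \<beta>^2 / \<mu> = (\<mu> - \<beta>) * (\<mu> + \<beta>) /
  \<mu>\<close>, the ratio can be pulled out of everything but \<open>s^2\<close>. For
  \<open>\<mu> > \<beta>\<close> the ratio is nondecreasing and the bracket strictly increasing,
  which the defining formula hides.\<close>

lemma block_gap_factor:
  assumes "0 \<le> \<beta>" "\<beta> < \<mu>"
  shows "block_gap \<beta> s \<mu> =
    (\<mu> - \<beta>) / (\<mu> + \<beta>) * (\<mu> + 2 * \<beta> + \<beta>\<^sup>2 / \<mu> - (1 + \<beta> - s)\<^sup>2) - s\<^sup>2"
proof -
  have "(\<mu> - \<beta>) * (\<mu> + 2 * \<beta> + \<beta>\<^sup>2 / \<mu>) = (\<mu> - \<beta>\<^sup>2 / \<mu>) * (\<mu> + \<beta>)"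
    using assms by (simp add: field_simps power2_eq_square)
  hence "(\<mu> - \<beta>) / (\<mu> + \<beta>) * (\<mu> + 2 * \<beta> + \<beta>\<^sup>2 / \<mu>) = \<mu> - \<beta>\<^sup>2 / \<mu>"
    using assms by (simp add: nonzero_divide_eq_eq)
  thus ?thesis
    unfolding block_gap_def by (simp add: algebra_simps)
qed

text \<open>The factors \<open>k\<close> and \<open>j\<close> of the factored form both grow.
  Positivity of the gap at \<open>\<mu>\<close> makes \<open>j \<mu>\<close> positive, so that
  enlarging \<open>k\<close> cannot lower the product.\<close>

lemma block_gap_strict_mono:
  assumes "0 \<le> \<beta>" "\<beta> < \<mu>" "\<mu> < \<nu>" "0 < block_gap \<beta> s \<mu>"
  shows "block_gap \<beta> s \<mu> < block_gap \<beta> s \<nu>"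
proof -
  define k where "k x = (x - \<beta>) / (x + \<beta>)" for x
  define j where "j x = x + 2 * \<beta> + \<beta>\<^sup>2 / x - (1 + \<beta> - s)\<^sup>2" for x
  have k: "0 < k \<mu>" "k \<mu> \<le> k \<nu>"
    using assms by (auto simp: k_def field_simps intro!: mult_left_mono)
  have "\<beta>\<^sup>2 < \<mu> * \<nu>"
    unfolding power2_eq_square using assms by (intro mult_strict_mono) auto
  hence "0 < (\<nu> - \<mu>) * (1 - \<beta>\<^sup>2 / (\<mu> * \<nu>))"
    using assms by (intro mult_pos_pos) (auto simp: divide_simps)
  also have "\<dots> = j \<nu> - j \<mu>"
    using assms by (simp add: j_def field_simps)
  finally have j: "j \<mu> < j \<nu>" by simp
  have fac: "block_gap \<beta> s \<mu> = k \<mu> * j \<mu> - s\<^sup>2" "block_gap \<beta> s \<nu> = k \<nu> * j \<nu> - s\<^sup>2"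
    using assms block_gap_factor[of \<beta>] by (auto simp: k_def j_def)
  have "0 < k \<mu> * j \<mu>"
    using assms(4) fac(1) zero_le_power2[of s] by linarith
  hence "0 < j \<mu>"
    using k(1) by (simp add: zero_less_mult_iff)
  have "k \<mu> * j \<mu> < k \<mu> * j \<nu>" using k(1) j by simp
  also have "\<dots> \<le> k \<nu> * j \<nu>" using k(2) j \<open>0 < j \<mu>\<close> by (intro mult_right_mono) auto
  finally show ?thesis using fac by simp
qed

text \<open>This is the determinant condition \<open>m^2 < p * v\<close> for the eigenvector block.
  A positive gap forces the bracket of \<open>block_gap_factor\<close> to be positive, and
  \<open>\<mu>\<close> times that bracket is the difference of the two sides.\<close>

lemma block_gap_posD:
  assumes "0 \<le> \<beta>" "\<beta> < \<mu>" "0 < block_gap \<beta> s \<mu>"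
  shows "(1 + \<beta> - s)\<^sup>2 * \<mu> < (\<mu> + \<beta>)\<^sup>2"
proof -
  have "0 < (\<mu> - \<beta>) / (\<mu> + \<beta>) * (\<mu> + 2 * \<beta> + \<beta>\<^sup>2 / \<mu> - (1 + \<beta> - s)\<^sup>2)"
    using assms block_gap_factor[of \<beta> \<mu> s] zero_le_power2[of s] by linarith
  moreover have "0 < (\<mu> - \<beta>) / (\<mu> + \<beta>)" using assms by simp
  ultimately have "0 < \<mu> + 2 * \<beta> + \<beta>\<^sup>2 / \<mu> - (1 + \<beta> - s)\<^sup>2"
    using zero_less_mult_pos by blast
  hence "0 < \<mu> * (\<mu> + 2 * \<beta> + \<beta>\<^sup>2 / \<mu> - (1 + \<beta> - s)\<^sup>2)"
    using assms by (intro mult_pos_pos) auto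
  also have "\<dots> = (\<mu> + \<beta>)\<^sup>2 - (1 + \<beta> - s)\<^sup>2 * \<mu>"
    using assms by (simp add: field_simps power2_eq_square)
  finally show ?thesis by simp
qed

text \<open>Serves twice: it makes the gap nonpositive at \<open>\<mu> = s^2\<close>, and it yields
  the lower bound on the spectral radius.\<close>

lemma block_gap_le:
  assumes "0 \<le> \<beta>" "\<beta> \<le> \<mu>"
  shows "block_gap \<beta> s \<mu> \<le> \<mu> - s\<^sup>2"
proof -
  have "0 \<le> (1 + \<beta> - s)\<^sup>2 * (\<mu> - \<beta>) / (\<mu> + \<beta>)" "0 \<le> \<beta>\<^sup>2 / \<mu>"
    using assms by (auto intro!: divide_nonneg_nonneg mult_nonneg_nonneg)
  thus ?thesis by (simp add: block_gap_def)
qed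

lemma block_gap_ge:
  assumes "0 \<le> \<beta>" "\<beta> < 1" "1 \<le> \<mu>"
  shows "\<mu> - (1 + \<beta> - s)\<^sup>2 - 1 - s\<^sup>2 \<le> block_gap \<beta> s \<mu>"
proof -
  have "(1 + \<beta> - s)\<^sup>2 * ((\<mu> - \<beta>) / (\<mu> + \<beta>)) \<le> (1 + \<beta> - s)\<^sup>2 * 1"
    using assms by (intro mult_left_mono) auto
  moreover have "\<beta>\<^sup>2 \<le> 1 * \<mu>"
    using assms by (smt (verit) power_le_one)
  hence "\<beta>\<^sup>2 / \<mu> \<le> 1"
    using assms by (simp add: field_simps)
  ultimately show ?thesis by (simp add: block_gap_def)
qed

text \<open>With \<open>a = \<eta> * lam i\<close> this turns positivity of the gap at 1 into
  \<open>a < 1 + \<beta>\<close>, and the quotient at 1 into a summand of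
  \<open>S_adam\<close>.\<close>

lemma block_gap_one:
  assumes "0 \<le> \<beta>" "\<beta> < 1"
  shows "block_gap \<beta> ((1 - \<beta>) * a) 1 = 2 * (1 - \<beta>)\<^sup>2 * a * (1 - a / (1 + \<beta>))"
  using assms by (simp add: block_gap_def field_simps power2_eq_square)

lemma block_gap_beta:
  assumes "0 < \<beta>"
  shows "block_gap \<beta> s \<beta> = - s\<^sup>2"
  using assms by (simp add: block_gap_def power2_eq_square)

lemma continuous_on_block_gap:
  assumes "0 \<le> \<beta>" "A \<subseteq> {0<..}"
  shows "continuous_on A (block_gap \<beta> s)"
  unfolding block_gap_def[abs_def]
  using assms by (intro continuous_intros) (auto simp: subset_iff add_pos_nonneg less_imp_neq[symmetric])

section \<open>The secular equation: existence of a root and monotonicity\<close>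

text \<open>Intermediate value theorem between a point where block 0 alone contributes 2 and a point
  where every block contributes at most \<open>1 / d\<close>.\<close>

lemma secular_root_exists:
  fixes s :: "nat \<Rightarrow> real"
  assumes d: "d \<ge> 1" and b: "0 \<le> \<beta>" "\<beta> < 1" and s: "\<And>i. i < d \<Longrightarrow> 0 < s i"
  obtains r where "\<beta> < r" "\<And>i. i < d \<Longrightarrow> 0 < block_gap \<beta> (s i) r"
    "(\<Sum>i<d. (s i)\<^sup>2 / block_gap \<beta> (s i) r) = 1"
proof -
  \<comment> \<open>The truncation keeps the function continuous down to \<open>x0\<close>; it is inactive wherever the
    value is at most 1, because then every gap is at least \<open>(s i)\<^sup>2\<close>.\<close>
  define f where "f x = (\<Sum>i<d. (s i)\<^sup>2 / max (block_gap \<beta> (s i) x) ((s i)\<^sup>2 / 2))" for x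
  \<comment> \<open>The gap of block 0 is nonpositive here: it is \<open>- (s 0)^2\<close> at a
    positive \<open>\<beta>\<close>, and \<open>block_gap_le\<close> applies at
    \<open>(s 0)^2\<close>. So the truncation is active and that quotient equals 2. The maximum also
    keeps \<open>x0\<close> positive when \<open>\<beta> = 0\<close>.\<close>
  define x0 where "x0 = max \<beta> ((s 0)\<^sup>2)"
  \<comment> \<open>Chosen so that \<open>block_gap_ge\<close> gives a gap of at least
    \<open>d * (s i)^2\<close> in each block: the sum absorbs the subtracted squares and leaves
    \<open>d\<close> copies of \<open>(s i)^2\<close>.\<close>
  define M where "M = 2 + x0 + (\<Sum>i<d. (1 + \<beta> - s i)\<^sup>2 + (d + 1) * (s i)\<^sup>2)"
  have s2: "0 < (s i)\<^sup>2" if "i < d" for i using s[OF that] by simp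
  have nonneg: "0 \<le> (s i)\<^sup>2 / max (block_gap \<beta> (s i) x) ((s i)\<^sup>2 / 2)" for i x
    by (intro divide_nonneg_nonneg) (auto simp: le_max_iff_disj)
  have x0: "0 < x0" "\<beta> \<le> x0" using s2[of 0] d by (auto simp: x0_def less_max_iff_disj)
  have "block_gap \<beta> (s 0) x0 \<le> 0"
  proof (cases "x0 = \<beta>")
    case True
    with x0 show ?thesis by (simp add: block_gap_beta)
  next
    case False
    hence "x0 = (s 0)\<^sup>2" by (auto simp: x0_def max_def split: if_splits)
    with block_gap_le[OF b(1) x0(2), of "s 0"] show ?thesis by simp
  qed
  hence "max (block_gap \<beta> (s 0) x0) ((s 0)\<^sup>2 / 2) = (s 0)\<^sup>2 / 2"
    using zero_le_power2[of "s 0"] by (intro max_absorb2) linarith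
  hence "2 = (s 0)\<^sup>2 / max (block_gap \<beta> (s 0) x0) ((s 0)\<^sup>2 / 2)"
    using s2[of 0] d by simp
  also have "\<dots> \<le> f x0"
    unfolding f_def using d nonneg by (intro member_le_sum) auto
  finally have f0: "1 \<le> f x0" by simp
  have M: "x0 \<le> M" "1 \<le> M"
    using x0 by (auto simp: M_def intro!: sum_nonneg add_nonneg_nonneg)
  have "f M \<le> (\<Sum>i<d. 1 / real d)"
    unfolding f_def
  proof (intro sum_mono)
    fix i assume i: "i \<in> {..<d}"
    have "(1 + \<beta> - s i)\<^sup>2 + (d + 1) * (s i)\<^sup>2 \<le>
      (\<Sum>i<d. (1 + \<beta> - s i)\<^sup>2 + (d + 1) * (s i)\<^sup>2)"
      using i by (intro member_le_sum) auto
    hence "d * (s i)\<^sup>2 \<le> M - (1 + \<beta> - s i)\<^sup>2 - 1 - (s i)\<^sup>2"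
      using x0 by (simp add: M_def algebra_simps)
    also have "\<dots> \<le> block_gap \<beta> (s i) M"
      using block_gap_ge b M by blast
    finally have "d * (s i)\<^sup>2 \<le> max (block_gap \<beta> (s i) M) ((s i)\<^sup>2 / 2)" by simp
    moreover have "0 < max (block_gap \<beta> (s i) M) ((s i)\<^sup>2 / 2)"
      using s2[of i] i by (simp add: less_max_iff_disj)
    ultimately show "(s i)\<^sup>2 / max (block_gap \<beta> (s i) M) ((s i)\<^sup>2 / 2) \<le> 1 / real d"
      using d by (simp add: field_simps)
  qed
  hence fM: "f M \<le> 1" using d by simp
  have "continuous_on {x0..M} f"
    unfolding f_def
  proof (intro continuous_on_sum continuous_on_divide continuous_on_const continuous_on_max
      continuous_on_block_gap b ballI)
    fix i x assume "i \<in> {..<d}"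
    hence "0 < max (block_gap \<beta> (s i) x) ((s i)\<^sup>2 / 2)"
      using s2[of i] by (simp add: less_max_iff_disj)
    thus "max (block_gap \<beta> (s i) x) ((s i)\<^sup>2 / 2) \<noteq> 0" by simp
  qed (use x0 in auto)
  from IVT2'[OF fM f0 M(1) this] obtain r where r: "x0 \<le> r" "f r = 1" by auto
  have gap: "(s i)\<^sup>2 \<le> block_gap \<beta> (s i) r" if "i < d" for i
  proof -
    have "(s i)\<^sup>2 / max (block_gap \<beta> (s i) r) ((s i)\<^sup>2 / 2) \<le> f r"
      unfolding f_def using that nonneg by (intro member_le_sum) auto
    moreover have "0 < max (block_gap \<beta> (s i) r) ((s i)\<^sup>2 / 2)"
      using s2[OF that] by (simp add: less_max_iff_disj)
    ultimately have "(s i)\<^sup>2 \<le> max (block_gap \<beta> (s i) r) ((s i)\<^sup>2 / 2)"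
      using r(2) by (simp add: pos_divide_le_eq del: max_less_iff_conj)
    with s2[OF that] show ?thesis by (auto simp: le_max_iff_disj)
  qed
  have "max (block_gap \<beta> (s i) r) ((s i)\<^sup>2 / 2) = block_gap \<beta> (s i) r" if "i < d" for i
    using gap[OF that] s2[OF that] by (intro max_absorb1) linarith
  hence F: "(\<Sum>i<d. (s i)\<^sup>2 / block_gap \<beta> (s i) r) = 1"
    using r(2) by (simp add: f_def)
  \<comment> \<open>If \<open>r = \<beta>\<close>, then \<open>\<beta> \<ge> x0 > 0\<close>, so the
    gap of block 0 would be \<open>- (s 0)^2\<close>, against its lower bound
    \<open>(s 0)^2\<close>.\<close>
  have "r \<noteq> \<beta>"
    using gap[of 0] s2[of 0] d x0 r(1) block_gap_beta[of \<beta> "s 0"] by auto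
  hence "\<beta> < r" using x0 r(1) by auto
  moreover have "0 < block_gap \<beta> (s i) r" if "i < d" for i
    using s2[OF that] gap[OF that] by (rule less_le_trans)
  ultimately show thesis using F that by blast
qed

text \<open>Every denominator is positive and grows strictly. This later decides on which side of 1
  the root lies.\<close>

lemma secular_sum_strict_antimono:
  fixes s :: "nat \<Rightarrow> real"
  assumes "d \<ge> 1" "0 \<le> \<beta>" "\<beta> < \<mu>" "\<mu> < \<nu>"
    and "\<And>i. i < d \<Longrightarrow> 0 < s i" "\<And>i. i < d \<Longrightarrow> 0 < block_gap \<beta> (s i) \<mu>"
  shows "(\<Sum>i<d. (s i)\<^sup>2 / block_gap \<beta> (s i) \<nu>) < (\<Sum>i<d. (s i)\<^sup>2 / block_gap \<beta> (s i) \<mu>)"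
proof (intro sum_strict_mono)
  fix i assume "i \<in> {..<d}"
  then show "(s i)\<^sup>2 / block_gap \<beta> (s i) \<nu> < (s i)\<^sup>2 / block_gap \<beta> (s i) \<mu>"
    using assms(5,6)[of i] block_gap_strict_mono[of \<beta> \<mu> \<nu> "s i"] assms(2-4)
    by (intro divide_strict_left_mono mult_pos_pos) auto
qed (use assms in \<open>auto simp: lessThan_empty_iff\<close>)

section \<open>Quadratic forms and invariance of the cone\<close>

text \<open>The form of a symmetric matrix at a real vector, without conjugation for complex
  matrices. Real vectors already determine the matrix, so a real form can be compared with a complex
  one pointwise.\<close>

definition qform :: "'a::{comm_ring_1,real_algebra_1} mat \<Rightarrow> real \<Rightarrow> real \<Rightarrow> 'a" where
  "qform V x y = of_real (x\<^sup>2) * V $$ (0,0) + of_real (2 * x * y) * V $$ (0,1) + of_real (y\<^sup>2) * V $$ (1,1)"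

lemma T_adam_entries:
  fixes W :: "nat \<Rightarrow> 'a::{comm_ring_1,real_algebra_1} mat" and \<sigma> lam :: "nat \<Rightarrow> real" and \<eta> \<beta> :: real
  assumes W: "W \<in> X_space d" and i: "i < d"
  defines "s \<equiv> (1 - \<beta>) * \<eta> * lam i"
  defines "c \<equiv> of_real (((1 - \<beta>) * \<eta>)\<^sup>2) * (of_real ((lam i)\<^sup>2) * W i $$ (0,0) +
           of_real (1 / \<sigma> i) * (\<Sum>j<d. of_real (\<sigma> j * (lam j)\<^sup>2) * W j $$ (0,0)))"
  shows "T_adam d \<sigma> lam \<eta> \<beta> W i \<in> carrier_mat 2 2"
    "T_adam d \<sigma> lam \<eta> \<beta> W i $$ (0,0) = of_real ((1 - s)\<^sup>2) * W i $$ (0,0)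
       - of_real (2 * \<beta> * (1 - s)) * W i $$ (0,1) + of_real (\<beta>\<^sup>2) * W i $$ (1,1) + c"
    "T_adam d \<sigma> lam \<eta> \<beta> W i $$ (0,1) = of_real (s * (1 - s)) * W i $$ (0,0)
       + of_real (\<beta> * (1 - 2 * s)) * W i $$ (0,1) - of_real (\<beta>\<^sup>2) * W i $$ (1,1) - c"
    "T_adam d \<sigma> lam \<eta> \<beta> W i $$ (1,0) = T_adam d \<sigma> lam \<eta> \<beta> W i $$ (0,1)"
    "T_adam d \<sigma> lam \<eta> \<beta> W i $$ (1,1) = of_real (s\<^sup>2) * W i $$ (0,0)
       + of_real (2 * \<beta> * s) * W i $$ (0,1) + of_real (\<beta>\<^sup>2) * W i $$ (1,1) + c"
proof -
  have car: "W i \<in> carrier_mat 2 2" and tr: "(W i)\<^sup>T = W i"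
    using W i by (auto simp: X_space_def)
  have sym: "W i $$ (Suc 0, 0) = W i $$ (0, Suc 0)"
    using car arg_cong[OF tr, of "\<lambda>M. M $$ (0, Suc 0)"] by simp
  note [simp] = A_adam_def Q_adam_def mat_of_rows_list_def scalar_prod_def T_adam_def Let_def sym
    numeral_2_eq_2 carrier_matD[OF car]
  show "T_adam d \<sigma> lam \<eta> \<beta> W i \<in> carrier_mat 2 2"
    using i by (simp add: c_def)
  show "T_adam d \<sigma> lam \<eta> \<beta> W i $$ (0,0) = of_real ((1 - s)\<^sup>2) * W i $$ (0,0)
       - of_real (2 * \<beta> * (1 - s)) * W i $$ (0,1) + of_real (\<beta>\<^sup>2) * W i $$ (1,1) + c"
    using i by (simp add: s_def c_def algebra_simps)
  show "T_adam d \<sigma> lam \<eta> \<beta> W i $$ (0,1) = of_real (s * (1 - s)) * W i $$ (0,0)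
       + of_real (\<beta> * (1 - 2 * s)) * W i $$ (0,1) - of_real (\<beta>\<^sup>2) * W i $$ (1,1) - c"
    using i by (simp add: s_def c_def algebra_simps)
  show "T_adam d \<sigma> lam \<eta> \<beta> W i $$ (1,0) = T_adam d \<sigma> lam \<eta> \<beta> W i $$ (0,1)"
    using i by (simp add: algebra_simps)
  show "T_adam d \<sigma> lam \<eta> \<beta> W i $$ (1,1) = of_real (s\<^sup>2) * W i $$ (0,0)
       + of_real (2 * \<beta> * s) * W i $$ (0,1) + of_real (\<beta>\<^sup>2) * W i $$ (1,1) + c"
    using i by (simp add: s_def c_def algebra_simps)
qed


text \<open>The form of \<open>A * W * A^T\<close> at \<open>z\<close> is that of \<open>W\<close>
  at \<open>A^T z\<close>, and \<open>Q_adam\<close> is the rank-one matrix of the vector (1, -1).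
  All coefficients of the noise term are nonnegative for positive \<open>\<sigma>\<close>, which is
  the source of positivity.\<close>

lemma qform_T_adam:
  fixes W :: "nat \<Rightarrow> 'a::{comm_ring_1,real_algebra_1} mat" and \<sigma> lam :: "nat \<Rightarrow> real" and \<eta> \<beta> :: real
  assumes W: "W \<in> X_space d" and i: "i < d"
  shows "qform (T_adam d \<sigma> lam \<eta> \<beta> W i) x y =
    qform (W i) ((1 - (1 - \<beta>) * \<eta> * lam i) * x + (1 - \<beta>) * \<eta> * lam i * y) (\<beta> * (y - x)) +
    of_real ((x - y)\<^sup>2) * (of_real (((1 - \<beta>) * \<eta>)\<^sup>2) * (of_real ((lam i)\<^sup>2) * W i $$ (0,0) +
      of_real (1 / \<sigma> i) * (\<Sum>j<d. of_real (\<sigma> j * (lam j)\<^sup>2) * W j $$ (0,0))))"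
proof -
  have "of_real x * of_real x * ((1 - s) * (1 - s) * a - 2 * b * (1 - s) * m + b * b * v + c) +
      2 * of_real x * of_real y * (s * (1 - s) * a + b * (1 - 2 * s) * m - b * b * v - c) +
      of_real y * of_real y * (s * s * a + 2 * b * s * m + b * b * v + c) =
      ((1 - s) * of_real x + s * of_real y) * ((1 - s) * of_real x + s * of_real y) * a +
      2 * ((1 - s) * of_real x + s * of_real y) * (b * (of_real y - of_real x)) * m +
      b * (of_real y - of_real x) * (b * (of_real y - of_real x)) * v +
      (of_real x - of_real y) * (of_real x - of_real y) * c"
    for s a b m v c :: 'a
    by (simp add: algebra_simps)
  thus ?thesis
    unfolding qform_def T_adam_entries[OF W i] of_real_add of_real_mult of_real_diff of_real_power
      of_real_1 of_real_numeral power2_eq_square .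
qed

lemma mat_2_eqI:
  assumes "M \<in> carrier_mat 2 2" "N \<in> carrier_mat 2 2"
    and "M $$ (0,0) = N $$ (0,0)" "M $$ (0,1) = N $$ (0,1)"
    and "M $$ (1,0) = N $$ (1,0)" "M $$ (1,1) = N $$ (1,1)"
  shows "M = N"
proof (rule eq_matI)
  fix i j assume "i < dim_row N" "j < dim_col N"
  hence "i = 0 \<or> i = 1" "j = 0 \<or> j = 1" using assms(2) by auto
  thus "M $$ (i, j) = N $$ (i, j)" using assms by auto
qed (use assms in auto)

lemma mat_of_rows_list_2:
  "mat_of_rows_list 2 [[a, b], [c, e]] \<in> carrier_mat 2 2"
  "mat_of_rows_list 2 [[a, b], [c, e]] $$ (0,0) = a" "mat_of_rows_list 2 [[a, b], [c, e]] $$ (0,1) = b"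
  "mat_of_rows_list 2 [[a, b], [c, e]] $$ (1,0) = c" "mat_of_rows_list 2 [[a, b], [c, e]] $$ (1,1) = e"
  by (simp_all add: mat_of_rows_list_def numeral_2_eq_2)

lemma symmetric_mat_2_iff:
  assumes "M \<in> carrier_mat 2 2"
  shows "M\<^sup>T = M \<longleftrightarrow> M $$ (1,0) = M $$ (0,1)"
proof
  assume "M\<^sup>T = M"
  from arg_cong[OF this, of "\<lambda>M. M $$ (0,1)"] show "M $$ (1,0) = M $$ (0,1)"
    using assms by simp
next
  assume "M $$ (1,0) = M $$ (0,1)"
  thus "M\<^sup>T = M" using assms by (intro mat_2_eqI) auto
qed

lemma psd_mat_2_iff:
  "psd_mat 2 M \<longleftrightarrow> M \<in> carrier_mat 2 2 \<and> M\<^sup>T = M \<and> (\<forall>x y. 0 \<le> qform M x y)"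
proof (cases "M \<in> carrier_mat 2 2 \<and> M\<^sup>T = M")
  case True
  hence car: "M \<in> carrier_mat 2 2" and sym: "M $$ (1,0) = M $$ (0,1)"
    using symmetric_mat_2_iff by auto
  have q: "v \<bullet> (M *\<^sub>v v) = qform M (v $ 0) (v $ 1)" if "v \<in> carrier_vec 2" for v
    using car sym that
    by (simp add: qform_def scalar_prod_def numeral_2_eq_2 power2_eq_square algebra_simps)
  have "0 \<le> qform M x y" if "\<And>v. v \<in> carrier_vec 2 \<Longrightarrow> 0 \<le> v \<bullet> (M *\<^sub>v v)" for x y
    using that[of "vec 2 (\<lambda>k. if k = 0 then x else y)"] q[of "vec 2 (\<lambda>k. if k = 0 then x else y)"]
    by simp
  with True q show ?thesis by (auto simp: psd_mat_def)
qed (auto simp: psd_mat_def)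

lemma T_adam_in_X_space:
  assumes "W \<in> X_space d"
  shows "T_adam d \<sigma> lam \<eta> \<beta> W \<in> X_space d"
  unfolding X_space_def
proof (safe)
  fix i assume i: "i < d"
  show car: "T_adam d \<sigma> lam \<eta> \<beta> W i \<in> carrier_mat 2 2"
    by (rule T_adam_entries(1)[OF assms i])
  show "(T_adam d \<sigma> lam \<eta> \<beta> W i)\<^sup>T = T_adam d \<sigma> lam \<eta> \<beta> W i"
    using T_adam_entries(4)[OF assms i] symmetric_mat_2_iff[OF car] by blast
qed (simp add: T_adam_def Let_def)

lemma T_adam_in_K_cone:
  assumes W: "W \<in> K_cone d" and spos: "\<And>i. i < d \<Longrightarrow> 0 < \<sigma> i"
  shows "T_adam d \<sigma> lam \<eta> \<beta> W \<in> K_cone d"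
proof -
  have X: "W \<in> X_space d" and psd: "\<And>i. i < d \<Longrightarrow> psd_mat 2 (W i)"
    using W by (auto simp: K_cone_def)
  have TX: "T_adam d \<sigma> lam \<eta> \<beta> W \<in> X_space d"
    by (rule T_adam_in_X_space[OF X])
  have q: "0 \<le> qform (W i) x y" if "i < d" for i x y
    using psd[OF that] by (simp add: psd_mat_2_iff)
  have W00: "0 \<le> W i $$ (0,0)" if "i < d" for i
    using q[OF that, of 1 0] by (simp add: qform_def)
  have "psd_mat 2 (T_adam d \<sigma> lam \<eta> \<beta> W i)" if i: "i < d" for i
  proof -
    have "0 \<le> qform (T_adam d \<sigma> lam \<eta> \<beta> W i) x y" for x y
      unfolding qform_T_adam[OF X i] of_real_eq_id id_apply
      using q[OF i] W00 i spos
      by (intro add_nonneg_nonneg mult_nonneg_nonneg sum_nonneg divide_nonneg_nonneg)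
        (auto intro: less_imp_le)
    with TX i show ?thesis by (auto simp: psd_mat_2_iff X_space_def)
  qed
  with TX show ?thesis by (simp add: K_cone_def)
qed

section \<open>Domination of complex eigenvectors by an interior eigenvector\<close>

text \<open>A positive definite matrix is an order unit: the complex form is at most a multiple of
  the squared norm, the positive definite one at least a positive multiple of it.\<close>

lemma qform_pos_def_dominates:
  fixes V :: "complex mat" and W :: "real mat"
  assumes "0 < W $$ (0,0)" "(W $$ (0,1))\<^sup>2 < W $$ (0,0) * W $$ (1,1)"
  obtains C where "0 \<le> C" "\<And>x y. cmod (qform V x y) \<le> C * qform W x y"
proof -
  define p q v where "p = W $$ (0,0)" and "q = W $$ (0,1)" and "v = W $$ (1,1)"
  define N where "N = cmod (V $$ (0,0)) + cmod (V $$ (0,1)) + cmod (V $$ (1,1))"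
  have pq: "0 < p" "q\<^sup>2 < p * v" using assms by (auto simp: p_def q_def v_def)
  hence "0 < p * v" by (smt (verit) zero_le_power2)
  hence v: "0 < v" using pq(1) by (simp add: zero_less_mult_iff)
  have V: "cmod (qform V x y) \<le> N * (x\<^sup>2 + y\<^sup>2)" for x y
  proof -
    have xy: "\<bar>2 * x * y\<bar> \<le> x\<^sup>2 + y\<^sup>2"
      using sum_squares_bound[of x y] sum_squares_bound[of x "-y"] by (simp add: abs_le_iff)
    have "cmod (qform V x y) \<le> cmod (of_real (x\<^sup>2) * V $$ (0,0)) +
        cmod (of_real (2 * x * y) * V $$ (0,1)) + cmod (of_real (y\<^sup>2) * V $$ (1,1))"
      unfolding qform_def by (rule order_trans[OF norm_triangle_ineq add_right_mono[OF norm_triangle_ineq]])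
    also have "\<dots> = x\<^sup>2 * cmod (V $$ (0,0)) + \<bar>2 * x * y\<bar> * cmod (V $$ (0,1)) + y\<^sup>2 * cmod (V $$ (1,1))"
      unfolding norm_mult norm_of_real by simp
    also have "\<dots> \<le> (x\<^sup>2 + y\<^sup>2) * cmod (V $$ (0,0)) + (x\<^sup>2 + y\<^sup>2) * cmod (V $$ (0,1)) +
        (x\<^sup>2 + y\<^sup>2) * cmod (V $$ (1,1))"
      using xy by (intro add_mono mult_right_mono) auto
    finally show ?thesis by (simp add: N_def algebra_simps)
  qed
  \<comment> \<open>The smallest eigenvalue of a positive definite 2x2 matrix is at least determinant over trace.\<close>
  have W: "(p * v - q\<^sup>2) * (x\<^sup>2 + y\<^sup>2) \<le> (p + v) * qform W x y" for x y
  proof -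
    \<comment> \<open>By Cayley-Hamilton, trace times \<open>W\<close> minus determinant times the
      identity is the square of \<open>W\<close>; its form is the squared norm of the image of
      \<open>(x, y)\<close>.\<close>
    have "(p + v) * qform W x y - (p * v - q\<^sup>2) * (x\<^sup>2 + y\<^sup>2) = (p * x + q * y)\<^sup>2 + (q * x + v * y)\<^sup>2"
      by (simp add: qform_def p_def q_def v_def power2_eq_square algebra_simps)
    thus ?thesis by (smt (verit) zero_le_power2)
  qed
  show thesis
  proof (rule that[of "N * (p + v) / (p * v - q\<^sup>2)"])
    show "0 \<le> N * (p + v) / (p * v - q\<^sup>2)"
      using pq v by (simp add: N_def)
    fix x y
    have "x\<^sup>2 + y\<^sup>2 \<le> (p + v) * qform W x y / (p * v - q\<^sup>2)"
      using W[of x y] pq by (simp add: pos_le_divide_eq mult.commute)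
    hence "N * (x\<^sup>2 + y\<^sup>2) \<le> N * ((p + v) * qform W x y / (p * v - q\<^sup>2))"
      by (intro mult_left_mono) (auto simp: N_def)
    with V[of x y] show "cmod (qform V x y) \<le> N * (p + v) / (p * v - q\<^sup>2) * qform W x y"
      by simp
  qed
qed

lemma qform_nonneg:
  fixes W :: "real mat"
  assumes "0 < W $$ (0,0)" "(W $$ (0,1))\<^sup>2 < W $$ (0,0) * W $$ (1,1)"
  shows "0 \<le> qform W x y"
proof -
  define p q v where "p = W $$ (0,0)" and "q = W $$ (0,1)" and "v = W $$ (1,1)"
  have "p * qform W x y = (p * x + q * y)\<^sup>2 + (p * v - q\<^sup>2) * y\<^sup>2"
    by (simp add: qform_def p_def q_def v_def power2_eq_square algebra_simps)
  moreover have "0 \<le> (p * x + q * y)\<^sup>2 + (p * v - q\<^sup>2) * y\<^sup>2"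
    using assms by (simp add: p_def q_def v_def)
  ultimately have "0 \<le> p * qform W x y" by simp
  thus ?thesis using assms(1) by (simp add: p_def zero_le_mult_iff)
qed

lemma qform_X_smult:
  assumes "W \<in> X_space d" "i < d"
  shows "qform (X_smult c W i) x y = c * qform (W i) x y"
  using assms by (auto simp: qform_def X_smult_def X_space_def algebra_simps)

lemma mat_2_zero_if_qform_zero:
  fixes V :: "complex mat"
  assumes "V \<in> carrier_mat 2 2" "V\<^sup>T = V" "\<And>x y. qform V x y = 0"
  shows "V = 0\<^sub>m 2 2"
proof -
  have "V $$ (0,0) = 0" "V $$ (1,1) = 0"
    using assms(3)[of 1 0] assms(3)[of 0 1] by (auto simp: qform_def)
  moreover from this have "V $$ (0,1) = 0" using assms(3)[of 1 1] by (simp add: qform_def)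
  ultimately show ?thesis
    using assms symmetric_mat_2_iff[of V] by (intro mat_2_eqI) auto
qed

text \<open>If \<open>C\<close> times the form of \<open>W\<close> dominates \<open>V\<close>,
  applying the operator to both improves the constant by the factor \<open>r / cmod \<mu>\<close>.
  Were this below 1, iterating would force \<open>V\<close> to vanish.\<close>

lemma cmod_eigenvalue_le:
  fixes W :: "nat \<Rightarrow> real mat" and V :: "nat \<Rightarrow> complex mat"
  assumes spos: "\<And>i. i < d \<Longrightarrow> 0 < \<sigma> i"
    and W: "W \<in> X_space d" "T_adam d \<sigma> lam \<eta> \<beta> W = X_smult r W"
    and W_pos: "\<And>i. i < d \<Longrightarrow> 0 < W i $$ (0,0)"
      "\<And>i. i < d \<Longrightarrow> (W i $$ (0,1))\<^sup>2 < W i $$ (0,0) * W i $$ (1,1)"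
    and V: "V \<in> X_space d" "V \<noteq> X_zero" "T_adam d \<sigma> lam \<eta> \<beta> V = X_smult \<mu> V"
    and r: "0 < r"
  shows "cmod \<mu> \<le> r"
proof (rule ccontr)
  assume "\<not> cmod \<mu> \<le> r"
  hence \<mu>: "r < cmod \<mu>" by simp
  define dom where "dom C \<longleftrightarrow> 0 \<le> C \<and> (\<forall>i<d. \<forall>x y. cmod (qform (V i) x y) \<le> C * qform (W i) x y)" for C
  have "\<exists>C\<ge>0. \<forall>x y. cmod (qform (V i) x y) \<le> C * qform (W i) x y" if "i < d" for i
    by (rule qform_pos_def_dominates[OF W_pos[OF that], of "V i"]) blast
  then obtain c where c: "\<And>i. i < d \<Longrightarrow> 0 \<le> c i"
    "\<And>i x y. i < d \<Longrightarrow> cmod (qform (V i) x y) \<le> c i * qform (W i) x y"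
    by metis
  have W_nonneg: "0 \<le> qform (W i) x y" if "i < d" for i x y
    by (rule qform_nonneg[OF W_pos[OF that]])
  \<comment> \<open>The operator couples the blocks, so one constant must serve all of them; the sum
    of the blockwise constants does.\<close>
  have dom0: "dom (\<Sum>i<d. c i)"
    unfolding dom_def
  proof (intro conjI allI impI)
    fix i x y assume i: "i < d"
    have "c i \<le> (\<Sum>i<d. c i)" using i c(1) by (intro member_le_sum) auto
    hence "c i * qform (W i) x y \<le> (\<Sum>i<d. c i) * qform (W i) x y"
      using W_nonneg[OF i] by (intro mult_right_mono)
    with c(2)[OF i, of x y] show "cmod (qform (V i) x y) \<le> (\<Sum>i<d. c i) * qform (W i) x y" by linarith
  qed (use c in \<open>auto intro: sum_nonneg\<close>)
  \<comment> \<open>Positivity of the operator carries the domination through one application.\<close>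
  have step: "dom (C * (r / cmod \<mu>))" if C: "dom C" for C
    unfolding dom_def
  proof (intro conjI allI impI)
    show "0 \<le> C * (r / cmod \<mu>)" using C r \<mu> by (simp add: dom_def)
    have CV: "cmod (qform (V i) x y) \<le> C * qform (W i) x y" if "i < d" for i x y
      using C that by (auto simp: dom_def)
    have CV0: "cmod (V i $$ (0,0)) \<le> C * W i $$ (0,0)" if "i < d" for i
      using CV[OF that, of 1 0] by (simp add: qform_def)
    fix i x y assume i: "i < d"
    \<comment> \<open>The pair \<open>(?X, ?Y)\<close> is \<open>A^T (x, y)\<close>;
      \<open>?h\<close> and \<open>?k\<close> are the nonnegative weights of the own and the coupled
      top-left entries in \<open>qform_T_adam\<close>.\<close>
    let ?X = "(1 - (1 - \<beta>) * \<eta> * lam i) * x + (1 - \<beta>) * \<eta> * lam i * y"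
    let ?Y = "\<beta> * (y - x)"
    let ?k = "\<lambda>j. (x - y)\<^sup>2 * ((1 - \<beta>) * \<eta>)\<^sup>2 * (1 / \<sigma> i) * (\<sigma> j * (lam j)\<^sup>2)"
    let ?h = "(x - y)\<^sup>2 * ((1 - \<beta>) * \<eta>)\<^sup>2 * (lam i)\<^sup>2"
    have k: "0 \<le> ?k j" if "j < d" for j
      using spos[OF i] spos[OF that] by simp
    have "cmod \<mu> * cmod (qform (V i) x y) = cmod (qform (T_adam d \<sigma> lam \<eta> \<beta> V i) x y)"
      by (simp add: V qform_X_smult[OF V(1) i] norm_mult)
    also have "qform (T_adam d \<sigma> lam \<eta> \<beta> V i) x y = qform (V i) ?X ?Y +
        (of_real ?h * V i $$ (0,0) + (\<Sum>j<d. of_real (?k j) * V j $$ (0,0)))"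
      unfolding qform_T_adam[OF V(1) i]
      by (simp only: of_real_mult distrib_left sum_distrib_left mult.assoc)
    also have "cmod \<dots> \<le> cmod (qform (V i) ?X ?Y) +
        (cmod (of_real ?h * V i $$ (0,0)) + (\<Sum>j<d. cmod (of_real (?k j) * V j $$ (0,0))))"
      by (rule order_trans[OF norm_triangle_ineq add_left_mono[OF
        order_trans[OF norm_triangle_ineq add_left_mono[OF norm_sum]]]])
    also have "\<dots> = cmod (qform (V i) ?X ?Y) +
        (?h * cmod (V i $$ (0,0)) + (\<Sum>j<d. ?k j * cmod (V j $$ (0,0))))"
      unfolding norm_mult[of "of_real _"] norm_of_real
      by (intro arg_cong2[where f = "(+)"] arg_cong2[where f = "(*)"] sum.cong refl abs_of_nonneg)
        (use k in auto)
    also have "\<dots> \<le> C * qform (W i) ?X ?Y +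
        (?h * (C * W i $$ (0,0)) + (\<Sum>j<d. ?k j * (C * W j $$ (0,0))))"
      using CV[OF i] CV0 i k by (intro add_mono mult_left_mono sum_mono) auto
    also have "\<dots> = C * qform (T_adam d \<sigma> lam \<eta> \<beta> W i) x y"
      unfolding qform_T_adam[OF W(1) i] of_real_eq_id id_apply
      by (simp only: distrib_left sum_distrib_left mult_ac)
    also have "\<dots> = C * r * qform (W i) x y"
      by (simp add: W qform_X_smult[OF W(1) i])
    finally have "cmod (qform (V i) x y) * cmod \<mu> \<le> C * r * qform (W i) x y"
      by (simp only: mult.commute)
    moreover have "0 < cmod \<mu>" using \<mu> r by linarith
    ultimately show "cmod (qform (V i) x y) \<le> C * (r / cmod \<mu>) * qform (W i) x y"
      by (simp add: pos_le_divide_eq)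
  qed
  have dom_n: "dom ((\<Sum>i<d. c i) * (r / cmod \<mu>) ^ n)" for n
  proof (induction n)
    case (Suc n)
    from step[OF this] show ?case by (simp add: mult_ac)
  qed (use dom0 in simp)
  have ratio: "r / cmod \<mu> < 1"
    using r \<mu> by (subst pos_divide_less_eq) auto
  have zero: "qform (V i) x y = 0" if i: "i < d" for i x y
  proof -
    have "(\<lambda>n. (\<Sum>i<d. c i) * (r / cmod \<mu>) ^ n * qform (W i) x y) \<longlonglongrightarrow> (\<Sum>i<d. c i) * 0 * qform (W i) x y"
      using r ratio by (intro tendsto_intros LIMSEQ_power_zero) simp
    moreover have "cmod (qform (V i) x y) \<le> (\<Sum>i<d. c i) * (r / cmod \<mu>) ^ n * qform (W i) x y" for n
      using dom_n[of n] i unfolding dom_def by blast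
    ultimately have "cmod (qform (V i) x y) \<le> (\<Sum>i<d. c i) * 0 * qform (W i) x y"
      by (intro LIMSEQ_le_const) blast+
    thus ?thesis by simp
  qed
  have "V i = X_zero i" for i
  proof (cases "i < d")
    case True
    thus ?thesis
      using V(1) mat_2_zero_if_qform_zero[OF _ _ zero[OF True]] by (simp add: X_space_def X_zero_def)
  qed (use V(1) in \<open>simp add: X_space_def X_zero_def\<close>)
  with V(2) show False by auto
qed


section \<open>The explicit eigenvector built from a root\<close>

text \<open>In the coordinates \<open>(x, x + y)\<close> the matrix \<open>A_adam\<close> becomes a companion matrix. With respect
  to them the block below is \<open>[[p, m], [m, v]]\<close>, and the eigenvalue equation for \<open>\<mu>\<close> forces
  \<open>m = (1 + \<beta> - s) p / (\<mu> + \<beta>)\<close> and \<open>v = p / \<mu>\<close>.\<close>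

definition perron_vec :: "nat \<Rightarrow> real \<Rightarrow> (nat \<Rightarrow> real) \<Rightarrow> (nat \<Rightarrow> real) \<Rightarrow> real \<Rightarrow> nat \<Rightarrow>
    'a::{comm_ring_1,real_algebra_1} mat" where
  "perron_vec d \<beta> \<sigma> s \<mu> i =
     (if i < d then
        let p = 1 / (\<sigma> i * block_gap \<beta> (s i) \<mu>); m = (1 + \<beta> - s i) * p / (\<mu> + \<beta>); v = p / \<mu>
        in mat_of_rows_list 2
          [[of_real p, of_real (m - p)], [of_real (m - p), of_real (p - 2 * m + v)]]
      else 0\<^sub>m 2 2)"

text \<open>Returning from \<open>w = x + y\<close> to \<open>y = w - x\<close> turns the block
  \<open>[[p, m], [m, v]]\<close> into the off-diagonal entry \<open>m - p\<close> and the lower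
  entry \<open>p - 2 * m + v\<close>.\<close>

lemma perron_vec_entries:
  fixes \<sigma> s :: "nat \<Rightarrow> real" and \<beta> \<mu> :: real
  assumes "i < d"
  defines "p \<equiv> 1 / (\<sigma> i * block_gap \<beta> (s i) \<mu>)"
  defines "m \<equiv> (1 + \<beta> - s i) * p / (\<mu> + \<beta>)"
  defines "W \<equiv> perron_vec d \<beta> \<sigma> s \<mu> i :: 'a::{comm_ring_1,real_algebra_1} mat"
  shows "W $$ (0,0) = of_real p" "W $$ (0,1) = of_real (m - p)"
    "W $$ (1,0) = of_real (m - p)" "W $$ (1,1) = of_real (p - 2 * m + p / \<mu>)"
  by (simp_all only: W_def perron_vec_def assms(1) if_True Let_def p_def m_def mat_of_rows_list_2)

lemma perron_vec_carrier: "perron_vec d \<beta> \<sigma> s \<mu> i \<in> carrier_mat 2 2"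
  by (simp only: perron_vec_def Let_def mat_of_rows_list_2 zero_carrier_mat split: if_split) simp

lemma perron_vec_in_X_space: "perron_vec d \<beta> \<sigma> s \<mu> \<in> X_space d"
  unfolding X_space_def symmetric_mat_2_iff[OF perron_vec_carrier] mem_Collect_eq
  by (intro conjI allI impI perron_vec_carrier)
    (simp only: perron_vec_entries, simp add: perron_vec_def)

text \<open>The coordinate change has determinant 1, so the determinant is still
  \<open>p * v - m^2\<close>, which is positive by \<open>block_gap_posD\<close>.\<close>

lemma perron_vec_pos_def:
  assumes "0 \<le> \<beta>" "\<beta> < \<mu>" "i < d" "0 < \<sigma> i" "0 < block_gap \<beta> (s i) \<mu>"
  shows "0 < (perron_vec d \<beta> \<sigma> s \<mu> i $$ (0,0) :: real)"
    "(perron_vec d \<beta> \<sigma> s \<mu> i $$ (0,1))\<^sup>2 <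
       perron_vec d \<beta> \<sigma> s \<mu> i $$ (0,0) * (perron_vec d \<beta> \<sigma> s \<mu> i $$ (1,1) :: real)"
proof -
  define p where "p = 1 / (\<sigma> i * block_gap \<beta> (s i) \<mu>)"
  define m where "m = (1 + \<beta> - s i) * p / (\<mu> + \<beta>)"
  note entries = perron_vec_entries[where 'a = real, OF assms(3), of \<beta> \<sigma> s \<mu>, folded p_def, folded m_def]
  have p: "0 < p" using assms by (simp add: p_def)
  thus "0 < (perron_vec d \<beta> \<sigma> s \<mu> i $$ (0,0) :: real)" using entries by simp
  have \<mu>: "0 < \<mu>" "0 < \<mu> + \<beta>" using assms by auto
  have "(t * p / w)\<^sup>2 < p * (p / \<mu>)" if "t\<^sup>2 * \<mu> < w\<^sup>2" "0 < w" for t w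
  proof -
    have "p\<^sup>2 * (t\<^sup>2 * \<mu>) < p\<^sup>2 * w\<^sup>2"
      using p that(1) by (intro mult_strict_left_mono) auto
    thus ?thesis
      using \<mu>(1) that(2) by (simp add: power_divide power_mult_distrib divide_simps power2_eq_square mult_ac)
  qed
  from this[OF block_gap_posD[OF assms(1,2,5)] \<mu>(2)]
  have "m\<^sup>2 < p * (p / \<mu>)" by (simp only: m_def)
  thus "(perron_vec d \<beta> \<sigma> s \<mu> i $$ (0,1))\<^sup>2 <
       perron_vec d \<beta> \<sigma> s \<mu> i $$ (0,0) * (perron_vec d \<beta> \<sigma> s \<mu> i $$ (1,1) :: real)"
    unfolding entries of_real_eq_id id_apply by (simp add: power2_eq_square algebra_simps)
qed

text \<open>Here \<open>g * p\<close> stands for what the coupling has to contribute. With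
  \<open>t = 1 + \<beta> - s\<close>, in the coordinates \<open>(x, x + y)\<close> the image has
  entries \<open>p' = t^2 * p - 2 * \<beta> * t * m + \<beta>^2 * v + s^2 * p + g * p\<close>,
  \<open>m' = t * p - \<beta> * m\<close> and \<open>v' = p\<close>. The gap is made for
  \<open>p' = \<mu> * p\<close>; the choice of \<open>m\<close> and \<open>v\<close> settles the
  other two.\<close>

lemma block_eigen_equations:
  fixes \<beta> \<mu> s p :: real
  assumes "0 \<le> \<beta>" "\<beta> < \<mu>"
  defines "m \<equiv> (1 + \<beta> - s) * p / (\<mu> + \<beta>)" and "g \<equiv> block_gap \<beta> s \<mu>"
  shows "(1 - s)\<^sup>2 * p - 2 * \<beta> * (1 - s) * (m - p) + \<beta>\<^sup>2 * (p - 2 * m + p / \<mu>) + (s\<^sup>2 * p + g * p) = \<mu> * p"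
    "s * (1 - s) * p + \<beta> * (1 - 2 * s) * (m - p) - \<beta>\<^sup>2 * (p - 2 * m + p / \<mu>) - (s\<^sup>2 * p + g * p) = \<mu> * (m - p)"
    "s\<^sup>2 * p + 2 * \<beta> * s * (m - p) + \<beta>\<^sup>2 * (p - 2 * m + p / \<mu>) + (s\<^sup>2 * p + g * p) = \<mu> * (p - 2 * m + p / \<mu>)"
proof -
  define v where "v = p / \<mu>"
  have v: "\<mu> * v = p" using assms by (simp add: v_def)
  have m: "\<mu> * m = (1 + \<beta> - s) * p - \<beta> * m"
    using assms by (simp add: m_def field_simps)
  have "t\<^sup>2 * ((\<mu> - \<beta>) / (\<mu> + \<beta>)) * p = t\<^sup>2 * p - 2 * \<beta> * t * (t * p / (\<mu> + \<beta>))" for t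
  proof -
    have "(\<mu> - \<beta>) / (\<mu> + \<beta>) = 1 - 2 * \<beta> / (\<mu> + \<beta>)"
      using assms by (simp add: field_simps)
    thus ?thesis by (simp add: power2_eq_square right_diff_distrib left_diff_distrib)
  qed
  \<comment> \<open>Because \<open>(\<mu> - \<beta>) / (\<mu> + \<beta>) = 1 - 2 * \<beta> / (\<mu>
    + \<beta>)\<close>, the middle term of the gap splits into the \<open>p\<close> part and the
    \<open>m\<close> part of \<open>p'\<close>.\<close>
  from this[of "1 + \<beta> - s"]
  have g: "g * p = \<mu> * p - ((1 + \<beta> - s)\<^sup>2 * p - 2 * \<beta> * (1 + \<beta> - s) * m) - \<beta>\<^sup>2 * v - s\<^sup>2 * p"
    unfolding m_def[symmetric]
    by (simp only: g_def block_gap_def left_diff_distrib v_def times_divide_eq_left times_divide_eq_right)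
  show 1: "(1 - s)\<^sup>2 * p - 2 * \<beta> * (1 - s) * (m - p) + \<beta>\<^sup>2 * (p - 2 * m + p / \<mu>) + (s\<^sup>2 * p + g * p) = \<mu> * p"
    unfolding g v_def[symmetric] by (simp add: power2_eq_square algebra_simps)
  \<comment> \<open>The entry is \<open>m' - p'\<close>, with \<open>p' = \<mu> * p\<close> already
    known; the lower right entry below is likewise \<open>p' - 2 * m' + v'\<close>.\<close>
  have e: "s * (1 - s) * p + \<beta> * (1 - 2 * s) * (m - p) - \<beta>\<^sup>2 * (p - 2 * m + p / \<mu>) - (s\<^sup>2 * p + g * p)
      = ((1 + \<beta> - s) * p - \<beta> * m) - \<mu> * p"
    unfolding 1[symmetric] by (simp add: power2_eq_square algebra_simps)
  show "s * (1 - s) * p + \<beta> * (1 - 2 * s) * (m - p) - \<beta>\<^sup>2 * (p - 2 * m + p / \<mu>) - (s\<^sup>2 * p + g * p) = \<mu> * (m - p)"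
    unfolding e m[symmetric] by (simp add: algebra_simps)
  have "s\<^sup>2 * p + 2 * \<beta> * s * (m - p) + \<beta>\<^sup>2 * (p - 2 * m + p / \<mu>) + (s\<^sup>2 * p + g * p)
      = \<mu> * p - 2 * ((1 + \<beta> - s) * p - \<beta> * m) + p"
    unfolding 1[symmetric] by (simp add: power2_eq_square algebra_simps)
  also have "\<dots> = \<mu> * (p - 2 * m + v)"
    unfolding m[symmetric] using v by (simp add: algebra_simps)
  finally show "s\<^sup>2 * p + 2 * \<beta> * s * (m - p) + \<beta>\<^sup>2 * (p - 2 * m + p / \<mu>) + (s\<^sup>2 * p + g * p) = \<mu> * (p - 2 * m + p / \<mu>)"
    by (simp add: v_def)
qed

text \<open>The normalization \<open>p = 1 / (\<sigma> i * gap)\<close> presupposes that the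
  coupling sum times \<open>((1 - \<beta>) * \<eta>)^2\<close> is 1, since block \<open>i\<close>
  then receives \<open>1 / \<sigma> i = gap * p\<close>. As the \<open>\<sigma> j\<close> cancel in
  that sum, this is precisely the secular equation.\<close>

lemma T_adam_perron_vec:
  fixes \<sigma> lam :: "nat \<Rightarrow> real" and \<eta> \<beta> \<mu> :: real
  assumes b: "0 \<le> \<beta>" "\<beta> < \<mu>" and spos: "\<And>i. i < d \<Longrightarrow> 0 < \<sigma> i"
  defines "s \<equiv> \<lambda>i. (1 - \<beta>) * \<eta> * lam i"
  assumes gap: "\<And>i. i < d \<Longrightarrow> 0 < block_gap \<beta> (s i) \<mu>"
    and root: "(\<Sum>i<d. (s i)\<^sup>2 / block_gap \<beta> (s i) \<mu>) = 1"
  shows "T_adam d \<sigma> lam \<eta> \<beta> (perron_vec d \<beta> \<sigma> s \<mu>) =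
    X_smult (of_real \<mu>) (perron_vec d \<beta> \<sigma> s \<mu> :: nat \<Rightarrow> 'a::{comm_ring_1,real_algebra_1} mat)"
proof
  fix i
  let ?W = "perron_vec d \<beta> \<sigma> s \<mu> :: nat \<Rightarrow> 'a mat"
  show "T_adam d \<sigma> lam \<eta> \<beta> ?W i = X_smult (of_real \<mu>) ?W i"
  proof (cases "i < d")
    case True
    define p where "p = 1 / (\<sigma> i * block_gap \<beta> (s i) \<mu>)"
    define m where "m = (1 + \<beta> - s i) * p / (\<mu> + \<beta>)"
    note entries = perron_vec_entries[where 'a = 'a, OF True, of \<beta> \<sigma> s \<mu>, folded p_def, folded m_def]
    have "((1 - \<beta>) * \<eta>)\<^sup>2 * (\<Sum>j<d. \<sigma> j * (lam j)\<^sup>2 * (1 / (\<sigma> j * block_gap \<beta> (s j) \<mu>)))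
        = (\<Sum>i<d. (s i)\<^sup>2 / block_gap \<beta> (s i) \<mu>)"
      unfolding sum_distrib_left using spos
      by (intro sum.cong) (auto simp: s_def power_mult_distrib less_imp_neq[symmetric])
    hence "((1 - \<beta>) * \<eta>)\<^sup>2 * (\<Sum>j<d. \<sigma> j * (lam j)\<^sup>2 * (1 / (\<sigma> j * block_gap \<beta> (s j) \<mu>))) = 1"
      using root by simp
    hence "((1 - \<beta>) * \<eta>)\<^sup>2 * (1 / \<sigma> i * (\<Sum>j<d. \<sigma> j * (lam j)\<^sup>2 * (1 / (\<sigma> j * block_gap \<beta> (s j) \<mu>)))) = 1 / \<sigma> i"
      by (subst mult.left_commute) simp
    also have "1 / \<sigma> i = block_gap \<beta> (s i) \<mu> * p"
      using gap[OF True] by (simp add: p_def)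
    finally have "((1 - \<beta>) * \<eta>)\<^sup>2 * ((lam i)\<^sup>2 * p + 1 / \<sigma> i *
        (\<Sum>j<d. \<sigma> j * (lam j)\<^sup>2 * (1 / (\<sigma> j * block_gap \<beta> (s j) \<mu>)))) =
        (s i)\<^sup>2 * p + block_gap \<beta> (s i) \<mu> * p"
      unfolding distrib_left by (simp add: s_def power_mult_distrib)
    note c_real = this
    have sum: "(\<Sum>j<d. of_real (\<sigma> j * (lam j)\<^sup>2) * ?W j $$ (0,0)) =
        of_real (\<Sum>j<d. \<sigma> j * (lam j)\<^sup>2 * (1 / (\<sigma> j * block_gap \<beta> (s j) \<mu>)))"
      unfolding of_real_sum
      by (intro sum.cong refl) (simp only: perron_vec_entries lessThan_iff of_real_mult)
    have c: "of_real (((1 - \<beta>) * \<eta>)\<^sup>2) * (of_real ((lam i)\<^sup>2) * ?W i $$ (0,0) +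
        of_real (1 / \<sigma> i) * (\<Sum>j<d. of_real (\<sigma> j * (lam j)\<^sup>2) * ?W j $$ (0,0))) =
        of_real ((s i)\<^sup>2 * p + block_gap \<beta> (s i) \<mu> * p)"
      unfolding sum unfolding entries(1) of_real_mult[symmetric] of_real_add[symmetric] c_real ..
    have si: "(1 - \<beta>) * \<eta> * lam i = s i" by (simp add: s_def)
    note T = T_adam_entries[OF perron_vec_in_X_space True, where 'a = 'a, of \<sigma> lam \<eta> \<beta> \<beta> \<sigma> s \<mu>, unfolded c si]
    note eqs = block_eigen_equations[OF b, of "s i" p, folded m_def]
    show ?thesis
    proof (rule mat_2_eqI)
      show "T_adam d \<sigma> lam \<eta> \<beta> ?W i \<in> carrier_mat 2 2" by (rule T)
      show "X_smult (of_real \<mu>) ?W i \<in> carrier_mat 2 2"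
        by (simp add: X_smult_def perron_vec_carrier)
      have lt2: "1 < (2::nat)" by simp
      have smult: "X_smult (of_real \<mu>) ?W i $$ (k,l) = of_real \<mu> * ?W i $$ (k,l)" if "k < 2" "l < 2" for k l
        using perron_vec_carrier[of d \<beta> \<sigma> s \<mu> i, where 'a = 'a] that by (simp add: X_smult_def)
      show "T_adam d \<sigma> lam \<eta> \<beta> ?W i $$ (0,0) = X_smult (of_real \<mu>) ?W i $$ (0,0)"
        unfolding T(2) smult[OF pos2 pos2] entries of_real_mult[symmetric] of_real_add[symmetric]
          of_real_diff[symmetric] eqs(1) ..
      show 01: "T_adam d \<sigma> lam \<eta> \<beta> ?W i $$ (0,1) = X_smult (of_real \<mu>) ?W i $$ (0,1)"
        unfolding T(3) smult[OF pos2 lt2] entries of_real_mult[symmetric] of_real_add[symmetric]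
          of_real_diff[symmetric] eqs(2) ..
      show "T_adam d \<sigma> lam \<eta> \<beta> ?W i $$ (1,0) = X_smult (of_real \<mu>) ?W i $$ (1,0)"
        unfolding T(4) 01 smult[OF pos2 lt2] smult[OF lt2 pos2] entries ..
      show "T_adam d \<sigma> lam \<eta> \<beta> ?W i $$ (1,1) = X_smult (of_real \<mu>) ?W i $$ (1,1)"
        unfolding T(5) smult[OF lt2 lt2] entries of_real_mult[symmetric] of_real_add[symmetric]
          of_real_diff[symmetric] eqs(3) ..
    qed
  next
    case False
    thus ?thesis by (simp add: T_adam_def X_smult_def perron_vec_def Let_def)
  qed
qed

section \<open>The root as spectral radius, and its position relative to 1\<close>

theorem theoremA5:
  fixes d :: nat and P H Pinv R U :: "real mat"
    and \<sigma> lam :: "nat \<Rightarrow> real" and \<eta> \<beta> :: real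
  assumes d: "d \<ge> 1"
    and P: "pos_def_mat d P" and H: "psd_mat d H" and PH: "P * H = H * P"
    and Pinv: "Pinv \<in> carrier_mat d d" "Pinv * P = 1\<^sub>m d"
    and R: "pos_def_mat d R" "R * R = Pinv"
    and eig: "char_poly (Pinv * H) = (\<Prod>i<d. [:- lam i, 1:])"
    and sorted: "\<And>i j. i \<le> j \<Longrightarrow> j < d \<Longrightarrow> lam j \<le> lam i"
    and lpos: "\<And>i. i < d \<Longrightarrow> lam i > 0"
    and \<eta>: "\<eta> > 0" and \<beta>: "0 \<le> \<beta>" "\<beta> < 1"
    and spos: "\<And>i. i < d \<Longrightarrow> \<sigma> i > 0"
    and U: "U \<in> carrier_mat d d" "U\<^sup>T * U = 1\<^sub>m d"
    and UP: "U\<^sup>T * P * U = diag_of d \<sigma>"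
    and UH: "U\<^sup>T * (R * H * R) * U = diag_of d lam"
  shows "(\<forall>W \<in> K_cone d. T_adam d \<sigma> lam \<eta> \<beta> W \<in> K_cone d)
    \<and> (\<exists>Ws \<in> K_cone d. Ws \<noteq> X_zero
          \<and> T_adam d \<sigma> lam \<eta> \<beta> Ws = X_smult (rho_adam d \<sigma> lam \<eta> \<beta>) Ws
          \<and> (\<Sum>i<d. Ws i $$ (0,0)) > 0)
    \<and> rho_adam d \<sigma> lam \<eta> \<beta> \<ge> ((1 - \<beta>) * \<eta>)\<^sup>2 * (\<Sum>i<d. (lam i)\<^sup>2)
    \<and> ((1 - \<beta>) * \<eta>)\<^sup>2 * (\<Sum>i<d. (lam i)\<^sup>2) > 0
    \<and> (rho_adam d \<sigma> lam \<eta> \<beta> = 1 \<longleftrightarrow> \<eta> * lam 0 < 1 + \<beta> \<and> S_adam d lam \<eta> \<beta> = 1)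
    \<and> (rho_adam d \<sigma> lam \<eta> \<beta> < 1 \<longleftrightarrow> \<eta> * lam 0 < 1 + \<beta> \<and> S_adam d lam \<eta> \<beta> < 1)"
proof -
  define s where "s i = (1 - \<beta>) * \<eta> * lam i" for i
  have e: "0 < (1 - \<beta>) * \<eta>" using \<eta> \<beta> by simp
  have s: "0 < s i" if "i < d" for i using e lpos[OF that] by (simp add: s_def)
  obtain r where r: "\<beta> < r" "\<And>i. i < d \<Longrightarrow> 0 < block_gap \<beta> (s i) r"
    "(\<Sum>i<d. (s i)\<^sup>2 / block_gap \<beta> (s i) r) = 1"
    using secular_root_exists[of d \<beta> s] d \<beta> s by blast
  have s_abs: "s = (\<lambda>i. (1 - \<beta>) * \<eta> * lam i)" by (simp add: s_def fun_eq_iff)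
  have eigen: "T_adam d \<sigma> lam \<eta> \<beta> (perron_vec d \<beta> \<sigma> s r) =
      X_smult r (perron_vec d \<beta> \<sigma> s r :: nat \<Rightarrow> real mat)"
    using T_adam_perron_vec[where 'a = real, OF \<beta>(1) r(1) spos r(2,3)[unfolded s_abs]] by (simp add: s_abs)
  \<comment> \<open>The complex copy puts \<open>r\<close> into the set whose supremum is
    \<open>rho_adam\<close>; the real copy supplies the eigenvector in the cone and the upper bound
    for that set.\<close>
  have eigen_complex: "T_adam d \<sigma> lam \<eta> \<beta> (perron_vec d \<beta> \<sigma> s r) =
      X_smult (of_real r) (perron_vec d \<beta> \<sigma> s r :: nat \<Rightarrow> complex mat)"
    using T_adam_perron_vec[where 'a = complex, OF \<beta>(1) r(1) spos r(2,3)[unfolded s_abs]] by (simp add: s_abs)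
  define Ws where "Ws = (perron_vec d \<beta> \<sigma> s r :: nat \<Rightarrow> real mat)"
  have pd: "0 < Ws i $$ (0,0)" "(Ws i $$ (0,1))\<^sup>2 < Ws i $$ (0,0) * Ws i $$ (1,1)" if "i < d" for i
    unfolding Ws_def using perron_vec_pos_def[of \<beta> r i d \<sigma> s] \<beta> r that spos by blast+
  have WsX: "Ws \<in> X_space d" unfolding Ws_def by (rule perron_vec_in_X_space)
  have Ws_eigen: "T_adam d \<sigma> lam \<eta> \<beta> Ws = X_smult r Ws"
    using eigen by (simp add: Ws_def)
  have rho: "rho_adam d \<sigma> lam \<eta> \<beta> = r"
    unfolding rho_adam_def
  proof (rule cSup_eq_maximum)
    let ?V = "perron_vec d \<beta> \<sigma> s r :: nat \<Rightarrow> complex mat"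
    have "?V 0 $$ (0,0) \<noteq> 0"
      using d spos[of 0] r(2)[of 0] perron_vec_entries(1)[where 'a = complex, of 0 d \<beta> \<sigma> s r] by simp
    hence "?V \<noteq> X_zero" by (auto simp: X_zero_def)
    moreover have "cmod (of_real r) = r" using r(1) \<beta>(1) by simp
    ultimately show "r \<in> {cmod \<mu> | \<mu>. \<exists>W \<in> (X_space d :: (nat \<Rightarrow> complex mat) set).
        W \<noteq> X_zero \<and> T_adam d \<sigma> lam \<eta> \<beta> W = X_smult \<mu> W}"
      using perron_vec_in_X_space eigen_complex by (smt (verit) mem_Collect_eq)
  next
    fix x assume "x \<in> {cmod \<mu> | \<mu>. \<exists>W \<in> (X_space d :: (nat \<Rightarrow> complex mat) set).
        W \<noteq> X_zero \<and> T_adam d \<sigma> lam \<eta> \<beta> W = X_smult \<mu> W}"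
    thus "x \<le> r"
      using cmod_eigenvalue_le[OF spos WsX Ws_eigen] pd r(1) \<beta>(1) by auto
  qed
  have "psd_mat 2 (Ws i)" if i: "i < d" for i
  proof -
    have "0 \<le> qform (Ws i) x y" for x y
      by (rule qform_nonneg[OF pd[OF i]])
    thus ?thesis using WsX i by (auto simp: psd_mat_2_iff X_space_def)
  qed
  hence WsK: "Ws \<in> K_cone d" using WsX by (simp add: K_cone_def)
  have Ws_sum: "0 < (\<Sum>i<d. Ws i $$ (0,0))"
    using d pd by (intro sum_pos) (auto simp: lessThan_empty_iff)
  have Ws_nz: "Ws \<noteq> X_zero"
    using Ws_sum by (auto simp: X_zero_def)
  have lam_sum: "((1 - \<beta>) * \<eta>)\<^sup>2 * (\<Sum>i<d. (lam i)\<^sup>2) = (\<Sum>i<d. (s i)\<^sup>2)"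
    by (simp add: s_def sum_distrib_left power_mult_distrib)
  have lam_pos: "0 < (\<Sum>i<d. (s i)\<^sup>2)"
    using d s by (intro sum_pos zero_less_power) (auto simp: lessThan_empty_iff)
  have r0: "0 < r" using r(1) \<beta>(1) by simp
  \<comment> \<open>Each gap is at most \<open>r\<close>, so the secular equation gives that the sum
    of \<open>(s i)^2 / r\<close> is at most 1.\<close>
  have "(\<Sum>i<d. (s i)\<^sup>2 / r) \<le> (\<Sum>i<d. (s i)\<^sup>2 / block_gap \<beta> (s i) r)"
  proof (intro sum_mono divide_left_mono mult_pos_pos)
    fix i assume "i \<in> {..<d}"
    show "block_gap \<beta> (s i) r \<le> r"
      using block_gap_le[OF \<beta>(1), of r "s i"] r(1) zero_le_power2[of "s i"] by linarith
  qed (use r0 r(2) in auto)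
  hence bound: "(\<Sum>i<d. (s i)\<^sup>2) \<le> r"
    using r(3) r0 by (simp add: sum_divide_distrib[symmetric] field_simps)
  have gap1: "block_gap \<beta> (s i) 1 = 2 * (1 - \<beta>)\<^sup>2 * (\<eta> * lam i) * (1 - \<eta> * lam i / (1 + \<beta>))" for i
    using block_gap_one[OF \<beta>, of "\<eta> * lam i"] by (simp add: s_def mult.assoc)
  have gap1_pos: "0 < block_gap \<beta> (s i) 1 \<longleftrightarrow> \<eta> * lam i < 1 + \<beta>" if "i < d" for i
  proof -
    have "0 < 2 * (1 - \<beta>)\<^sup>2 * (\<eta> * lam i)" using lpos[OF that] \<eta> \<beta> by simp
    thus ?thesis
      unfolding gap1 using \<beta> by (subst zero_less_mult_iff) (auto simp: pos_divide_less_eq)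
  qed
  \<comment> \<open>Index 0 carries the largest \<open>lam\<close>, so its condition implies that of
    every block.\<close>
  have stable: "\<eta> * lam 0 < 1 + \<beta> \<longleftrightarrow> (\<forall>i<d. 0 < block_gap \<beta> (s i) 1)"
  proof
    assume "\<eta> * lam 0 < 1 + \<beta>"
    moreover have "\<eta> * lam i \<le> \<eta> * lam 0" if "i < d" for i
      using sorted[of 0 i] that \<eta> by simp
    ultimately show "\<forall>i<d. 0 < block_gap \<beta> (s i) 1"
      using gap1_pos by (auto intro: le_less_trans)
  qed (use gap1_pos[of 0] d in auto)
  \<comment> \<open>This also holds where a denominator vanishes: both quotients are then 0, by the
    convention for division by 0.\<close>
  have S: "S_adam d lam \<eta> \<beta> = (\<Sum>i<d. (s i)\<^sup>2 / block_gap \<beta> (s i) 1)"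
    unfolding S_adam_def
  proof (intro sum.cong refl)
    fix i assume i: "i \<in> {..<d}"
    define a where "a = \<eta> * lam i"
    define k where "k = 1 - a / (1 + \<beta>)"
    have "a \<noteq> 0" "1 - \<beta> \<noteq> 0" using lpos[of i] i \<eta> \<beta> by (auto simp: a_def)
    hence "((1 - \<beta>) * a)\<^sup>2 / (2 * (1 - \<beta>)\<^sup>2 * a * k) = a / (2 * k)"
      by (simp add: power2_eq_square)
    thus "\<eta> * lam i / (2 * (1 - \<eta> * lam i / (1 + \<beta>))) = (s i)\<^sup>2 / block_gap \<beta> (s i) 1"
      unfolding gap1 by (simp add: s_def a_def k_def mult.assoc)
  qed
  \<comment> \<open>Gaps positive at \<open>r\<close> stay positive when moving up to 1, so
    stability is a consequence here.\<close>
  have below: "(\<forall>i<d. 0 < block_gap \<beta> (s i) 1) \<and> S_adam d lam \<eta> \<beta> < 1" if "r < 1"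
  proof -
    have "0 < block_gap \<beta> (s i) 1" if "i < d" for i
      using block_gap_strict_mono[OF \<beta>(1) r(1) \<open>r < 1\<close> r(2)[OF that]] r(2)[OF that] by linarith
    moreover have "S_adam d lam \<eta> \<beta> < 1"
      using secular_sum_strict_antimono[where s = s, OF d \<beta>(1) r(1) that s r(2)] r(3) S by simp
    ultimately show ?thesis by blast
  qed
  \<comment> \<open>Moving down from \<open>r\<close> to 1 can destroy positivity of a gap, so it is
    assumed at 1; monotonicity is then applied upwards from 1.\<close>
  have above: "1 < S_adam d lam \<eta> \<beta>" if "1 < r" "\<forall>i<d. 0 < block_gap \<beta> (s i) 1"
    using secular_sum_strict_antimono[where s = s, OF d \<beta> that(1) s] that(2) r(3) S by simp
  have at: "(\<forall>i<d. 0 < block_gap \<beta> (s i) 1) \<and> S_adam d lam \<eta> \<beta> = 1" if "r = 1"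
    using r S that by simp
  \<comment> \<open>In the case \<open>r > 1\<close> either some gap at 1 is nonpositive or
    \<open>S_adam\<close> exceeds 1, which refutes both right-hand sides. The three cases therefore
    give the converse directions as well.\<close>
  have "r = 1 \<longleftrightarrow> \<eta> * lam 0 < 1 + \<beta> \<and> S_adam d lam \<eta> \<beta> = 1"
    unfolding stable using below above at by (cases r "1::real" rule: linorder_cases) auto
  moreover have "r < 1 \<longleftrightarrow> \<eta> * lam 0 < 1 + \<beta> \<and> S_adam d lam \<eta> \<beta> < 1"
    unfolding stable using below above at by (cases r "1::real" rule: linorder_cases) auto
  moreover have "\<forall>W \<in> K_cone d. T_adam d \<sigma> lam \<eta> \<beta> W \<in> K_cone d"
    using T_adam_in_K_cone spos by blast
  ultimately show ?thesis
    unfolding rho lam_sum using WsK Ws_nz Ws_eigen Ws_sum bound lam_pos by blast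
qed

end
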